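(* Let $q$ be a prime power and let $S,\bar S$ be subsets of $\mathbb{F}_q^\ast$ with $\sharp S=\sharp\bar S$. Let $f:\mathbb{F}_q^\ast\to\mathbb{F}_q^\ast$, $g:S\to\bar S$, $\lambda:\mathbb{F}_q^\ast\to S$ and $\bar\lambda:\mathbb{F}_q^\ast\to\bar S$ be maps such that $\lambda$ and $\bar\lambda$ are surjective and $\bar\lambda\circ f=g\circ\lambda$. Suppose that $f(x)=f_1(x)\,h(\lambda(x))$ for all $x\in\mathbb{F}_q^\ast$, where $f_1$ is a permutation of $\mathbb{F}_q^\ast$ and $h:S\to\mathbb{F}_q$ is a map, and that $f$ is a permutation of $\mathbb{F}_q^\ast$ (so that $g$ is a bijection). Let $f_1^{-1}, f^{-1}, g^{-1}$ be the compositional inverses of $f_1,f,g$ respectively. Then for all $x\in\mathbb{F}_q^\ast$, $$f^{-1}(x)=f_1^{-1}\left(\frac{x}{h(g^{-1}(\bar\lambda(x)))}\right).$$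
   Context: $\mathbb{F}_q$ is the finite field with $q$ elements and $\mathbb{F}_q^\ast=\mathbb{F}_q\setminus\{0\}$. $\sharp X$ denotes cardinality. Since $f$ and $f_1$ take values in $\mathbb{F}_q^\ast$ and $\lambda$ is surjective, $h$ is nowhere zero on $S$. By the AGW criterion, bijectivity of $f$ implies that $g:S\to\bar S$ is a bijection. *)

theory Defs
  imports "HOL-Library.FuncSet"
begin

text \<open>
  The finite field is a type of class \<open>{field, finite}\<close>; its cardinality \<open>q\<close> is then
  automatically a prime power.  Maps with a restricted domain are total functions constrained only
  on that domain, and the compositional inverse of a bijection with domain \<open>A\<close> is
  \<open>inv_into A\<close>, meaningful on its image of \<open>A\<close> only.
\<close>

abbreviation Fstar :: "'a::{field, finite} set"
  where "Fstar \<equiv> UNIV - {0}"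

end

theory Submission
  imports Defs
begin

text \<open>Write \<open>x = f y\<close>. The commuting square gives
  \<open>lambar x = g (lam y)\<close>, so once \<open>g\<close> is injective the value
  \<open>lam y\<close> can be read off from \<open>x\<close> alone. The factor
  \<open>h (lam y)\<close> is then known and nonzero; dividing \<open>x\<close> by it leaves
  \<open>f1 y\<close>, and inverting \<open>f1\<close> returns \<open>y\<close>.\<close>

theorem theorem3p1:
  fixes S Sbar :: "'a::{field, finite} set"
    and f f1 g h lam lambar :: "'a \<Rightarrow> 'a"
  assumes "S \<subseteq> Fstar" and "Sbar \<subseteq> Fstar" and "card S = card Sbar"
    and "f \<in> Fstar \<rightarrow> Fstar" and "g \<in> S \<rightarrow> Sbar"
    and "lam \<in> Fstar \<rightarrow> S" and "lambar \<in> Fstar \<rightarrow> Sbar"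
    and "lam ` Fstar = S" and "lambar ` Fstar = Sbar"
    and "\<forall>x\<in>Fstar. lambar (f x) = g (lam x)"
    and "\<forall>x\<in>Fstar. f x = f1 x * h (lam x)"
    and "bij_betw f1 Fstar Fstar"
    and "bij_betw f Fstar Fstar"
  shows "bij_betw g S Sbar \<and> (\<forall>s\<in>S. h s \<noteq> 0) \<and>
    (\<forall>x\<in>Fstar. inv_into Fstar f x =
       inv_into Fstar f1 (x / h (inv_into S g (lambar x))))"
proof -
  \<comment> \<open>Follow \<open>Fstar\<close> around the square: both \<open>lam\<close> and
    \<open>lambar\<close> are onto, and \<open>f\<close> permutes \<open>Fstar\<close>.\<close>
  have "g ` S = g ` lam ` Fstar"
    by (simp only: assms(8))
  also have "\<dots> = lambar ` f ` Fstar"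
    unfolding image_image using assms(10) by (intro image_cong) simp_all
  also have "\<dots> = Sbar"
    by (simp only: bij_betw_imp_surj_on[OF assms(13)] assms(9))
  finally have surj: "g ` S = Sbar" .
  \<comment> \<open>A surjection between finite sets of equal size is injective.\<close>
  then have inj: "inj_on g S"
    by (intro eq_card_imp_inj_on) (simp_all add: assms(3))
  have nz: "h s \<noteq> 0" if s: "s \<in> S" for s
  proof -
    obtain x where x: "x \<in> Fstar" "s = lam x"
      using s assms(8) by blast
    \<comment> \<open>A zero of \<open>h\<close> at \<open>lam x\<close> would force
      \<open>f x = 0\<close>.\<close>
    have "f x \<noteq> 0"
      using funcset_mem[OF assms(4) x(1)] by simp
    then show ?thesis
      using bspec[OF assms(11) x(1)] x(2) by auto
  qed
  have "inv_into Fstar f x = inv_into Fstar f1 (x / h (inv_into S g (lambar x)))"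
    if x: "x \<in> Fstar" for x
  proof -
    obtain y where y: "y \<in> Fstar" "x = f y"
      using x bij_betw_imp_surj_on[OF assms(13)] by blast
    have lam_y: "lam y \<in> S"
      using assms(6) y(1) by (rule funcset_mem)
    have "lambar x = g (lam y)"
      using bspec[OF assms(10) y(1)] y(2) by simp
    \<comment> \<open>The key step: \<open>lam y\<close> is expressed without the unknown
      \<open>y\<close>.\<close>
    then have "inv_into S g (lambar x) = lam y"
      using inj lam_y by (simp add: inv_into_f_f)
    moreover have "x = f1 y * h (lam y)"
      using bspec[OF assms(11) y(1)] y(2) by simp
    ultimately have "x / h (inv_into S g (lambar x)) = f1 y"
      using nz[OF lam_y] by simp
    \<comment> \<open>Both sides of the formula equal the preimage \<open>y\<close>.\<close>
    moreover have "inv_into Fstar f1 (f1 y) = y" "inv_into Fstar f x = y"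
      unfolding y(2) by (rule bij_betw_inv_into_left[OF _ y(1)], rule assms)+
    ultimately show ?thesis
      by simp
  qed
  with bij_betw_imageI[OF inj surj] nz show ?thesis
    by blast
qed

end
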